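(* Let $p_1=2<p_2=3<p_3<\cdots$ denote the prime numbers in increasing order and let $n\ge 1$. Let $\chi_4$ be the non-principal Dirichlet character modulo 4 (so $\chi_4(m)=0$ for even $m$, $\chi_4(m)=1$ for $m\equiv1\pmod 4$, $\chi_4(m)=-1$ for $m\equiv 3\pmod 4$), let $L(s,\chi_4)=\sum_{m\ge1}\chi_4(m)m^{-s}$, and define $$V_n(s)=L(s,\chi_4)\prod_{k=1}^n\left(1-\chi_4(p_k)p_k^{-s}\right).$$ Take $s=2p_n$. If $V_n(s)>1$, then $p_{n+1}\equiv 1\pmod 4$. If $V_n(s)<1$, then $p_{n+1}\equiv 3\pmod 4$.
   Context: $p_j$ denotes the $j$-th prime; $L(s,\chi_4)$ is the Dirichlet L-function of the non-principal character modulo 4, evaluated at real $s>1$. *)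

theory Defs
  imports "HOL-Analysis.Analysis" "HOL-Number_Theory.Number_Theory"
begin

text \<open>
  The primes are indexed from 1, so \<open>nth_prime 1 = 2\<close>; \<open>enumerate\<close> indexes from 0.
  The value \<open>nth_prime 0\<close> is meaningless.
\<close>

definition nth_prime :: "nat \<Rightarrow> nat" where
  "nth_prime k = enumerate {p. prime p} (k - 1)"

definition chi4 :: "nat \<Rightarrow> real" where
  "chi4 m = (if even m then 0 else if [m = 1] (mod 4) then 1 else -1)"

definition L_chi4 :: "real \<Rightarrow> real" where
  "L_chi4 s = (\<Sum>m. chi4 (Suc m) * real (Suc m) powr (-s))"

definition V :: "nat \<Rightarrow> real \<Rightarrow> real" where
  "V n s = L_chi4 s * (\<Prod>k=1..n. 1 - chi4 (nth_prime k) * real (nth_prime k) powr (-s))"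

end

theory Submission
  imports Defs
begin

text \<open>
  Multiplying \<open>L(s, \<chi>\<^sub>4)\<close> by the Euler factors at the primes up to \<open>p = p\<^sub>n\<close> leaves the sum of
  \<open>\<chi>\<^sub>4(m) m\<^bsup>-s\<^esup>\<close> over the \<open>m\<close> without prime factors up to \<open>p\<close>. With \<open>q = p\<^sub>n\<^sub>+\<^sub>1\<close> this is
  \<open>1 + \<chi>\<^sub>4(q) q\<^bsup>-s\<^esup> + E\<close>, and all \<open>m\<close> in the tail \<open>E\<close> are odd and larger than \<open>q\<close>, so comparison
  with an integral gives \<open>|E| \<le> q\<^bsup>1-s\<^esup> / (2 (s - 1))\<close>. For \<open>s = 2p\<close> this is below \<open>q\<^bsup>-s\<^esup>\<close> as soon as
  \<open>q < 4p - 2\<close>, so the sign of \<open>V\<^sub>n(s) - 1\<close> is \<open>\<chi>\<^sub>4(q)\<close>. The bound on \<open>q\<close> is a weak form of Bertrand's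
  postulate: if there were no prime in \<open>(n, 4n - 4]\<close>, then \<open>lcm(1, ..., 4n - 4)\<close>, which is at least
  \<open>4\<^bsup>2n-2\<^esup> / 2\<close>, would be at most the primorial of \<open>n\<close> (at most \<open>4\<^sup>n\<close>) times the contribution of the
  primes below \<open>2 \<surd>n\<close>.
\<close>

section \<open>Lower bound for lcm(1, ..., 2n)\<close>

text \<open>Induction on \<open>n\<close>, then on \<open>k\<close>: entry \<open>Suc k\<close> of
  row \<open>Suc n\<close> follows from entry \<open>k\<close> of that row and entry
  \<open>k\<close> of row \<open>n\<close>.\<close>

lemma times_binomial_dvd_Lcm:
  assumes "1 \<le> k" "k \<le> n"
  shows "k * (n choose k) dvd Lcm {1..n}"
  using assms
proof (induction n arbitrary: k)
  case (Suc n)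
  show ?case
    using Suc.prems
  proof (induction k rule: dec_induct)
    case base
    show ?case by (auto intro!: dvd_Lcm)
  next
    case (step k)
    define L where "L = Lcm {1..Suc n}"
    define c where "c = n choose k"
    define c' where "c' = Suc n choose k"
    have k: "1 \<le> k" "k \<le> n" using step by auto
    have "Lcm {1..n} dvd L" unfolding L_def by (rule Lcm_subset) auto
    then have "k * c dvd L" using Suc.IH[OF k] dvd_trans unfolding c_def by blast
    then obtain x where x: "L = k * c * x" by (elim dvdE)
    have "k * c' dvd L" using step unfolding c'_def L_def by simp
    then obtain y where y: "L = k * c' * y" by (elim dvdE)
    have D: "Suc k * (Suc n choose Suc k) = Suc n * c"
      unfolding c_def using Suc_times_binomial_eq[of n k] by (simp only: mult_ac)
    have "(Suc n - k) * c' = Suc n * c"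
      unfolding c_def c'_def using k binomial_absorb_comp[of "Suc n" k] by simp
    then have rec: "(int n + 1 - int k) * int c' = (int n + 1) * int c"
      using k by (metis Suc_diff_le of_nat_Suc of_nat_diff of_nat_mult le_SucI add.commute)
    have pos: "c > 0" "c' > 0" unfolding c_def c'_def using k by auto
    \<comment> \<open>Leibniz harmonic triangle: the reciprocals of the numbers \<open>k * (n choose k)\<close> satisfy
      \<open>1 / (Suc n * c) = 1 / (k * c) - 1 / (k * c')\<close>; multiply by \<open>L\<close> and clear denominators.\<close>
    have "int k * (int k * (int c * int c')) * int L
        = int k * (int k * (int c * int c')) * ((int n + 1) * int c * (int x - int y))"
    proof -
      have 1: "int L = int k * int c * int x" "int L = int k * int c' * int y"
        using x y by (metis of_nat_mult)+
      have "int k * (int k * (int c * int c')) * ((int n + 1) * int c * (int x - int y))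
          = (int n + 1) * int c *
            (int k * int c' * (int k * int c * int x) - int k * int c * (int k * int c' * int y))"
        by (simp add: algebra_simps)
      also have "\<dots> = (int n + 1) * int c * (int k * int c' * int L - int k * int c * int L)"
        by (simp only: 1(1)[symmetric] 1(2)[symmetric])
      also have "\<dots> = int k * int c * int L * ((int n + 1) * int c' - (int n + 1) * int c)"
        by (simp add: algebra_simps)
      also have "(int n + 1) * int c' - (int n + 1) * int c = int k * int c'"
        using rec by (simp add: algebra_simps)
      finally show ?thesis by (simp add: algebra_simps)
    qed
    moreover have "int k * (int k * (int c * int c')) \<noteq> 0" using pos k by simp
    ultimately have "int L = (int n + 1) * int c * (int x - int y)"
      by (rule mult_left_cancel[THEN iffD1, rotated])
    then have "int L = int (Suc n * c) * (int x - int y)" by (simp add: algebra_simps)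
    then have "int (Suc n * c) dvd int L" by (rule dvdI)
    then show ?case unfolding D L_def by (simp only: of_nat_dvd_iff)
  qed
qed simp

text \<open>The central binomial coefficient is at least \<open>4 ^ n / (2 * n)\<close>; the factor
  \<open>n\<close> in the divisibility cancels that denominator.\<close>

lemma power4_le_Lcm: "4 ^ n \<le> 2 * Lcm {1..2 * n :: nat}"
proof (cases "n = 0")
  case False
  have "(4::real) ^ n \<le> real (2 * (n * ((2 * n) choose n)))"
    using central_binomial_lower_bound[of n] False by (simp add: field_simps)
  then have "4 ^ n \<le> 2 * (n * ((2 * n) choose n))"
    by (metis of_nat_le_iff of_nat_numeral of_nat_power)
  also have "n * ((2 * n) choose n) \<le> Lcm {1..2 * n}"
    using False by (intro dvd_imp_le times_binomial_dvd_Lcm) (auto simp: Lcm_0_iff intro!: Nat.gr0I)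
  finally show ?thesis by simp
qed simp

section \<open>Upper bounds for primorials and for lcm(1, ..., M)\<close>

lemma prime_power_dvd_Lcm:
  fixes A :: "nat set"
  assumes "prime p" "finite A" "A \<noteq> {}" "0 \<notin> A" "p ^ k dvd Lcm A"
  shows "\<exists>a\<in>A. p ^ k dvd a"
  using assms(2-5)
proof (induction A rule: finite_ne_induct)
  case (insert a A)
  have nz: "a \<noteq> 0" "Lcm A \<noteq> 0" using insert by (auto simp: Lcm_0_iff)
  have "k \<le> multiplicity p (lcm a (Lcm A))"
    using insert.prems nz assms(1) by (intro multiplicity_geI) (auto simp: lcm_eq_0_iff)
  also have "\<dots> = max (multiplicity p a) (multiplicity p (Lcm A))"
    using nz assms(1) by (simp add: multiplicity_lcm)
  finally have "p ^ k dvd a \<or> p ^ k dvd Lcm A"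
    by (auto simp: le_max_iff_disj intro: multiplicity_dvd')
  then show ?case using insert by auto
qed auto

lemma prod_primes_dvd:
  fixes m :: nat
  assumes "finite P" "\<And>p. p \<in> P \<Longrightarrow> prime p" "\<And>p. p \<in> P \<Longrightarrow> p dvd m"
  shows "\<Prod>P dvd m"
  using assms
proof (induction P rule: finite_induct)
  case (insert p P)
  have "coprime p (\<Prod>P)"
    using insert by (intro prod_coprime_right) (auto intro!: primes_coprime)
  then show ?case using insert by (auto intro: divides_mult)
qed simp

text \<open>Row \<open>2 * m + 1\<close> has two equal middle entries and total
  \<open>2 * 4 ^ m\<close>.\<close>

lemma odd_binomial_le_power4: "(2 * m + 1) choose m \<le> 4 ^ m"
proof -
  have "(2 * m + 1) choose m = (2 * m + 1) choose (m + 1)"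
    using binomial_symmetric[of m "2 * m + 1"] by simp
  then have "2 * ((2 * m + 1) choose m) = (\<Sum>k\<in>{m, m + 1}. (2 * m + 1) choose k)"
    by simp
  also have "\<dots> \<le> (\<Sum>k\<le>2 * m + 1. (2 * m + 1) choose k)"
    by (rule sum_mono2) auto
  also have "\<dots> = 2 * 4 ^ m"
    by (simp only: choose_row_sum) (simp add: power_mult)
  finally show ?thesis by simp
qed

text \<open>For \<open>n = 2 * m + 1\<close>, every prime in \<open>(m + 1, n]\<close> divides
  \<open>fact n\<close> but neither \<open>fact m\<close> nor \<open>fact (m + 1)\<close>, hence
  divides \<open>n choose m\<close>, which is at most \<open>4 ^ m\<close>. An even
  \<open>n > 2\<close> adds no prime.\<close>

lemma primorial_le_power4: "\<Prod>{p. prime p \<and> p \<le> n} \<le> (4::nat) ^ n"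
proof (induction n rule: less_induct)
  case (less n)
  consider "n \<le> 2" | "n > 2" "even n" | "n > 2" "odd n" by linarith
  then show ?case
  proof cases
    case 1
    then have "{p. prime p \<and> p \<le> n} \<subseteq> {2}" by (auto dest: prime_ge_2_nat)
    then have "{p. prime p \<and> p \<le> n} = {} \<or> {p. prime p \<and> p \<le> n} = {2}" by auto
    moreover have "n = 2" if "{p. prime p \<and> p \<le> n} = {2}"
    proof -
      have "2 \<in> {p. prime p \<and> p \<le> n}" using that by blast
      then show ?thesis using 1 by simp
    qed
    moreover have "(1::nat) \<le> 4 ^ n" by simp
    ultimately show ?thesis by (elim disjE) (simp_all only: prod.empty, simp)
  next
    case 2
    then have "\<not> prime n" using prime_odd_nat by blast
    then have "{p. prime p \<and> p \<le> n} = {p. prime p \<and> p \<le> n - 1}"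
      by (auto simp: le_less)
    moreover have "(4::nat) ^ (n - 1) \<le> 4 ^ n" by (rule power_increasing) auto
    ultimately show ?thesis using less[of "n - 1"] 2 by (metis diff_less less_trans order_trans zero_less_numeral zero_less_one)
  next
    case 3
    then obtain m where m: "n = 2 * m + 1" "m \<ge> 1" by (auto elim!: oddE)
    let ?A = "{p. prime p \<and> p \<le> m + 1}" and ?B = "{p. prime p \<and> m + 1 < p \<and> p \<le> n}"
    have "\<Prod>?B dvd n choose m"
    proof (rule prod_primes_dvd)
      fix p assume p: "p \<in> ?B"
      have "fact m * fact (m + 1) * (n choose m) = (fact n :: nat)"
        using binomial_fact_lemma[of m n] m by simp
      then have "p dvd fact m * fact (m + 1) * (n choose m)"
        using p by (simp add: prime_dvd_fact_iff)
      then show "p dvd n choose m"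
        using p prime_dvd_fact_iff[of p m] prime_dvd_fact_iff[of p "m + 1"]
        by (auto simp: prime_dvd_mult_iff simp del: fact_Suc)
    qed auto
    then have B: "\<Prod>?B \<le> 4 ^ m"
      using dvd_imp_le[of "\<Prod>?B" "n choose m"] odd_binomial_le_power4[of m] m by (simp add: le_trans)
    have "{p. prime p \<and> p \<le> n} = ?A \<union> ?B" using m by auto
    then have "\<Prod>{p. prime p \<and> p \<le> n} = \<Prod>?A * \<Prod>?B"
      by (simp, intro prod.union_disjoint) auto
    also have "\<dots> \<le> 4 ^ (m + 1) * 4 ^ m"
      using less[of "m + 1"] m B by (intro mult_mono) auto
    also have "\<dots> = 4 ^ n" using m by (simp add: power_add[symmetric])
    finally show ?thesis .
  qed
qed

text \<open>Each prime power dividing the lcm divides some element, so it is at most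
  \<open>M\<close>. Primes from \<open>t\<close> on occur only to the first power because
  \<open>M < t ^ 2\<close>, and at most \<open>t\<close> primes lie below \<open>t\<close>.\<close>

lemma Lcm_le_power_mult_primorial:
  fixes M t n :: nat
  assumes gap: "\<And>p. prime p \<Longrightarrow> p \<le> M \<Longrightarrow> p \<le> n" and "M < t ^ 2" "1 \<le> M"
  shows "Lcm {1..M} \<le> M ^ t * 4 ^ n"
proof -
  define L where "L = Lcm {1..M}"
  define P where "P = prime_factors L"
  have L: "L \<noteq> 0" unfolding L_def by (simp add: Lcm_0_iff)
  have pw: "p ^ multiplicity p L \<le> M" and pn: "p \<le> n" and pp: "prime p" if "p \<in> P" for p
  proof -
    show pp: "prime p" using that by (auto simp: P_def)
    have "p ^ multiplicity p L dvd L" by (rule multiplicity_dvd)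
    then obtain a where a: "a \<in> {1..M}" "p ^ multiplicity p L dvd a"
      using prime_power_dvd_Lcm[OF pp, of "{1..M}" "multiplicity p L"] \<open>1 \<le> M\<close>
      unfolding L_def[symmetric] by auto
    then show le: "p ^ multiplicity p L \<le> M" by (auto dest!: dvd_imp_le)
    have "p ^ 1 \<le> p ^ multiplicity p L"
      using that L pp prime_ge_1_nat[OF pp] by (intro power_increasing) (auto simp: P_def prime_factors_multiplicity)
    with le show "p \<le> n" using gap[OF pp] by simp
  qed
  have "L = (\<Prod>p\<in>P. p ^ multiplicity p L)"
    using prod_prime_factors[OF L] by (simp add: P_def)
  \<comment> \<open>The spare factor \<open>p\<close> at small primes lets the full product over
    \<open>P\<close> split off.\<close>
  also have "\<dots> \<le> (\<Prod>p\<in>P. (if p < t then M else 1) * p)"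
  proof (rule prod_mono)
    fix p assume p: "p \<in> P"
    show "0 \<le> p ^ multiplicity p L \<and> p ^ multiplicity p L \<le> (if p < t then M else 1) * p"
    proof (cases "p < t")
      case True
      then show ?thesis using pw[OF p] prime_ge_1_nat[OF pp[OF p]]
        by (auto intro: order_trans[OF pw[OF p]])
    next
      case False
      then have "t ^ 2 \<le> p ^ 2" by (intro power_mono) auto
      then have "p ^ multiplicity p L < p ^ 2" using pw[OF p] \<open>M < t ^ 2\<close> by linarith
      then have "multiplicity p L < 2"
        using pp[OF p] by (metis power_less_imp_less_exp prime_gt_1_nat)
      then have "p ^ multiplicity p L \<le> p ^ 1"
        using prime_ge_1_nat[OF pp[OF p]] by (intro power_increasing) auto
      then show ?thesis using False by simp
    qed
  qed
  also have "\<dots> = (\<Prod>p\<in>P. if p < t then M else 1) * \<Prod>P"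
    by (simp add: prod.distrib)
  also have "\<dots> \<le> M ^ t * 4 ^ n"
  proof (rule mult_mono)
    have "(\<Prod>p\<in>P. if p < t then M else 1) = M ^ card {p \<in> P. p < t}"
      by (simp add: P_def prod.If_cases Int_def)
    also have "card {p \<in> P. p < t} \<le> card {..<t}" by (rule card_mono) auto
    then have "M ^ card {p \<in> P. p < t} \<le> M ^ t"
      using \<open>1 \<le> M\<close> by (intro power_increasing) auto
    finally show "(\<Prod>p\<in>P. if p < t then M else 1) \<le> M ^ t" .
    have "P \<subseteq> {p. prime p \<and> p \<le> n}" using pn pp by auto
    then have "\<Prod>P dvd \<Prod>{p. prime p \<and> p \<le> n}" by (intro prod_dvd_prod_subset) auto
    then have "\<Prod>P \<le> \<Prod>{p. prime p \<and> p \<le> n}"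
      by (rule dvd_imp_le) (auto intro!: prod_pos dest: prime_gt_0_nat)
    then show "\<Prod>P \<le> 4 ^ n" using primorial_le_power4[of n] by linarith
  qed auto
  finally show ?thesis by (simp add: L_def)
qed

section \<open>A weak form of Bertrand's postulate\<close>

text \<open>An integer form of \<open>2 * x + 2 \<le> 2 powr (x / 3)\<close>; it is the reason for
  cubing the main inequality below.\<close>

lemma cube_le_power2:
  fixes x :: nat
  assumes "x \<ge> 16"
  shows "(2 * x + 2) ^ 3 \<le> 2 ^ x"
  using assms
proof (induction x rule: dec_induct)
  case (step x)
  have "(2 * Suc x + 2) ^ 3 \<le> 2 * (2 * x + 2) ^ 3"
  proof -
    \<comment> \<open>As polynomials in \<open>y\<close>, the two sides compare
      coefficientwise.\<close>
    obtain y where "x = 16 + y" using step le_Suc_ex by blast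
    then show ?thesis by (simp add: power3_eq_cube algebra_simps)
  qed
  with step show ?case by simp
qed simp

text \<open>The bound keeps the next prime below \<open>2 * (s - 1) = 4 * n - 2\<close> at
  \<open>s = 2 * n\<close>, as the tail estimate needs.\<close>

lemma prime_between_n_and_4n:
  fixes n :: nat
  assumes "n \<ge> 2"
  shows "\<exists>p. prime p \<and> n < p \<and> p \<le> 4 * n - 4"
proof (cases "n < 256")
  case True
  \<comment> \<open>Starting from 2, each prime of the chain is at most \<open>4 * m - 4\<close> for
    its predecessor \<open>m\<close>, so it serves all \<open>n\<close> from \<open>m\<close> up to
    just below itself.\<close>
  have "prime (3::nat)" "prime (7::nat)" "prime (23::nat)" "prime (83::nat)" "prime (317::nat)"
    by simp_all
  note primes = this
  consider "n = 2" | "3 \<le> n" "n < 7" | "7 \<le> n" "n < 23" | "23 \<le> n" "n < 83" | "83 \<le> n"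
    using assms by linarith
  then show ?thesis
  proof cases
    case 1 then show ?thesis using primes(1) by (intro exI[of _ 3] conjI) linarith+
  next
    case 2 then show ?thesis using primes(2) by (intro exI[of _ 7] conjI) linarith+
  next
    case 3 then show ?thesis using primes(3) by (intro exI[of _ 23] conjI) linarith+
  next
    case 4 then show ?thesis using primes(4) by (intro exI[of _ 83] conjI) linarith+
  next
    case 5 then show ?thesis using primes(5) True by (intro exI[of _ 317] conjI) linarith+
  qed
next
  case False
  show ?thesis
  proof (rule ccontr)
    assume gap: "\<not> ?thesis"
    define M where "M = 4 * n - 4"
    \<comment> \<open>The bound \<open>t\<close> above the square root of \<open>M\<close> will be
      \<open>2 * x + 2\<close>, whose square exceeds \<open>4 * n\<close>.\<close>
    define x where "x = floor_sqrt n"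
    have x: "x ^ 2 \<le> n" "n < (x + 1) ^ 2"
      using Suc_floor_sqrt_power2_gt[of n] by (auto simp: x_def)
    have x16: "x \<ge> 16"
    proof -
      have "(16::nat)^2 < (x + 1)^2" using x False by simp
      then show ?thesis using power_less_imp_less_base by fastforce
    qed
    have M: "M < (2 * x + 2) ^ 2" "1 \<le> M" "M = 2 * (2 * n - 2)"
      using x False by (auto simp: M_def power2_eq_square algebra_simps)
    have "4 ^ (2 * n - 2) \<le> 2 * Lcm {1..M}"
      using power4_le_Lcm[of "2 * n - 2"] M by simp
    also have "Lcm {1..M} \<le> M ^ (2 * x + 2) * 4 ^ n"
      using gap M(1,2) unfolding M_def by (intro Lcm_le_power_mult_primorial) (meson not_le)+
    also have "M ^ (2 * x + 2) \<le> ((2 * x + 2) ^ 2) ^ (2 * x + 2)"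
      using M by (intro power_mono) auto
    finally have 1: "4 ^ (2 * n - 2) \<le> 2 * (((2 * x + 2) ^ 2) ^ (2 * x + 2) * 4 ^ n)" by simp
    have "2 * n - 2 = (n - 2) + n" using False by simp
    then have "(4::nat) ^ (2 * n - 2) = 4 ^ (n - 2) * 4 ^ n"
      by (simp only: power_add)
    with 1 have "4 ^ (n - 2) * 4 ^ n \<le> (2 * ((2 * x + 2) ^ 2) ^ (2 * x + 2)) * 4 ^ n"
      by (simp only: mult.assoc)
    then have "4 ^ (n - 2) \<le> 2 * ((2 * x + 2) ^ 2) ^ (2 * x + 2)" by simp
    then have "(4 ^ (n - 2)) ^ 3 \<le> (2 * ((2 * x + 2) ^ 2) ^ (2 * x + 2)) ^ 3"
      by (rule power_mono) simp
    also have "\<dots> = 2 ^ 3 * ((2 * x + 2) ^ 3) ^ (2 * (2 * x + 2))"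
      by (simp only: power_mult_distrib power_mult[symmetric] mult_ac)
    also have "\<dots> \<le> 2 ^ 3 * (2 ^ x) ^ (2 * (2 * x + 2))"
      using cube_le_power2[OF x16] by (intro mult_left_mono power_mono) auto
    also have "\<dots> = 2 ^ (3 + x * (2 * (2 * x + 2)))"
      by (simp only: power_add power_mult)
    also have "(4 ^ (n - 2)) ^ 3 = (2::nat) ^ (2 * (n - 2) * 3)"
      unfolding power_mult by simp
    finally have "2 * (n - 2) * 3 \<le> 3 + x * (2 * (2 * x + 2))"
      by (rule power_le_imp_le_exp[rotated]) simp
    then have "6 * n \<le> 15 + 4 * x ^ 2 + 4 * x"
      using False by (simp add: power2_eq_square algebra_simps)
    \<comment> \<open>With \<open>x ^ 2 \<le> n\<close> this gives
      \<open>32 * x \<le> 2 * n \<le> 15 + 4 * x\<close>, which is absurd.\<close>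
    moreover have "16 * x \<le> x ^ 2" using x16 by (simp add: power2_eq_square)
    ultimately show False using x x16 by linarith
  qed
qed

section \<open>Removing Euler factors from a completely multiplicative sum\<close>

text \<open>One sieve step per prime: \<open>A\<close> splits into its members not divisible by
  \<open>p\<close> and the multiples \<open>p * A\<close>, and the latter contribute
  \<open>f p\<close> times the sum over \<open>A\<close>.\<close>

lemma infsum_coprime_to_primes:
  fixes f :: "nat \<Rightarrow> real"
  assumes mult: "\<And>a b. f (a * b) = f a * f b" and summable: "f summable_on UNIV"
    and "finite P" "\<And>p. p \<in> P \<Longrightarrow> prime p"
  shows "infsum f UNIV * (\<Prod>p\<in>P. 1 - f p) = infsum f {m. \<forall>p\<in>P. \<not> p dvd m}"
  using assms(3,4)
proof (induction P rule: finite_induct)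
  case (insert p P)
  define A where "A = {m. \<forall>p\<in>P. \<not> p dvd m}"
  define B where "B = {m. \<forall>q\<in>insert p P. \<not> q dvd m}"
  have p: "prime p" using insert by auto
  have sub: "f summable_on S" for S
    using summable by (rule summable_on_subset_banach) auto
  have "A = B \<union> (*) p ` A"
  proof (intro equalityI subsetI)
    fix m assume m: "m \<in> A"
    show "m \<in> B \<union> (*) p ` A"
    proof (cases "p dvd m")
      case True
      then obtain k where k: "m = p * k" by (elim dvdE)
      then have "k \<in> A" using m by (auto simp: A_def)
      then show ?thesis using k by auto
    qed (use m in \<open>auto simp: A_def B_def\<close>)
  next
    fix m assume "m \<in> B \<union> (*) p ` A"
    moreover have "\<not> q dvd p" if "q \<in> P" for q
      using that insert p by (metis insertCI primes_dvd_imp_eq)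
    ultimately show "m \<in> A"
      using insert by (auto simp: A_def B_def prime_dvd_mult_iff)
  qed
  then have "infsum f A = infsum f (B \<union> (*) p ` A)" by simp
  also have "\<dots> = infsum f B + infsum f ((*) p ` A)"
    by (rule infsum_Un_disjoint[OF sub sub]) (auto simp: B_def)
  also have "infsum f ((*) p ` A) = infsum (\<lambda>m. f p * f m) A"
    using prime_gt_0_nat[OF p] by (subst infsum_reindex) (auto simp: inj_on_def o_def mult)
  also have "\<dots> = f p * infsum f A" by (rule infsum_cmult_right[OF sub])
  finally have "infsum f B = infsum f A * (1 - f p)"
    unfolding right_diff_distrib mult.commute[of _ "f p"] by linarith
  moreover have "infsum f UNIV * (\<Prod>q\<in>P. 1 - f q) = infsum f A"
    using insert by (auto simp: A_def)
  ultimately show ?case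
    using insert(1,2) unfolding B_def by (simp add: mult.commute mult.left_commute)
qed simp

section \<open>The character modulo 4 and its L-series\<close>

lemma chi4_mod: "chi4 m = (if m mod 4 = 1 then 1 else if m mod 4 = 3 then -1 else 0)"
proof -
  have "even m \<longleftrightarrow> m mod 4 = 0 \<or> m mod 4 = 2" by presburger
  moreover have "m mod 4 < 4" by simp
  ultimately show ?thesis unfolding chi4_def cong_def by auto
qed

lemma chi4_mult: "chi4 (a * b) = chi4 a * chi4 b"
proof -
  have *: "k mod 4 \<in> {0, 1, 2, 3}" for k :: nat by auto
  have "a * b mod 4 = (a mod 4) * (b mod 4) mod 4" by (simp add: mod_mult_eq)
  then show ?thesis using *[of a] *[of b] unfolding chi4_mod by auto
qed

lemma abs_chi4_le: "\<bar>chi4 m\<bar> \<le> 1"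
  by (simp add: chi4_def)

text \<open>Absolute convergence for \<open>s > 1\<close> makes the sum unconditional, as the sieve
  requires; index 0 may be included because \<open>chi4 0 = 0\<close>.\<close>

lemma L_chi4_has_sum:
  assumes "s > 1"
  shows "((\<lambda>m. chi4 m * real m powr - s) has_sum L_chi4 s) UNIV"
proof -
  define f where "f = (\<lambda>m. chi4 m * real m powr - s)"
  have "summable (\<lambda>m. norm (f m))"
  proof (rule summable_comparison_test)
    show "summable (\<lambda>m. real m powr - s)" using assms by (simp add: summable_real_powr_iff)
    show "\<exists>N. \<forall>m\<ge>N. norm (norm (f m)) \<le> real m powr - s"
      using abs_chi4_le by (auto simp: f_def abs_mult intro!: mult_left_le_one_le)
  qed
  moreover have "f sums L_chi4 s"
  proof -
    have "summable f" using calculation by (rule summable_norm_cancel)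
    then have "summable (\<lambda>m. f (Suc m))" by (simp add: summable_Suc_iff)
    then have "(\<lambda>m. f (Suc m)) sums L_chi4 s"
      unfolding L_chi4_def f_def by (rule summable_sums)
    then show ?thesis using sums_Suc[of f "L_chi4 s"] by (simp add: f_def)
  qed
  ultimately show ?thesis unfolding f_def[symmetric] by (rule norm_summable_imp_has_sum)
qed

section \<open>Integral comparison for the tail\<close>

text \<open>Mean value theorem for a function with derivative \<open>- (y powr - s) / 2\<close>: the
  interval length 2 cancels the 1/2, and \<open>y powr - s\<close> is decreasing.\<close>

lemma powr_le_telescope:
  fixes s y :: real
  assumes "s > 1" "y > 0"
  shows "(y + 2) powr - s \<le> y powr (1 - s) / (2 * (s - 1)) - (y + 2) powr (1 - s) / (2 * (s - 1))"
proof -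
  define g where "g = (\<lambda>y. y powr (1 - s) / (2 * (s - 1)))"
  have "\<exists>z. y < z \<and> z < y + 2 \<and> g (y + 2) - g y = (y + 2 - y) * (- (z powr - s) / 2)"
  proof (rule MVT2)
    fix x assume "y \<le> x" "x \<le> y + 2"
    then have x: "x > 0" using assms by simp
    have "((\<lambda>y. y powr (1 - s)) has_real_derivative (1 - s) * x powr (1 - s - 1)) (at x)"
      by (rule has_real_derivative_powr[OF x])
    then have "(g has_real_derivative (1 - s) * x powr (1 - s - 1) / (2 * (s - 1))) (at x)"
      unfolding g_def by (rule DERIV_cdivide)
    also have "(1 - s) * x powr (1 - s - 1) / (2 * (s - 1)) = - (x powr - s) / 2"
      using assms by (simp add: field_simps)
    finally show "(g has_real_derivative - (x powr - s) / 2) (at x)" .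
  qed simp
  then obtain z where z: "y < z" "z < y + 2" "g y - g (y + 2) = z powr - s" by auto
  have "(y + 2) powr - s \<le> z powr - s"
    using z assms by (intro powr_mono2') auto
  with z show ?thesis by (simp add: g_def)
qed

text \<open>Only \<open>q + 2, q + 4, ...\<close> can occur in \<open>R\<close>, so the step-two
  differences telescope to the value at \<open>q\<close>.\<close>

lemma abs_infsum_step_two_tail_le:
  fixes f :: "nat \<Rightarrow> real" and s :: real and q :: nat
  assumes "s > 1" "q > 0" and R: "R \<subseteq> {m. q < m \<and> even (m - q)}"
    and f: "\<And>m. \<bar>f m\<bar> \<le> real m powr - s"
  shows "\<bar>infsum f R\<bar> \<le> real q powr (1 - s) / (2 * (s - 1))"
proof -
  define g where "g = (\<lambda>y. y powr (1 - s) / (2 * (s - 1)))"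
  define h where "h = (\<lambda>j. q + 2 * Suc j)"
  define D where "D = (\<lambda>m. g (real m - 2) - g (real m))"
  have bound: "(real q + 2 * real j + 2) powr - s \<le> D (h j)" for j
    using powr_le_telescope[of s "real q + 2 * real j"] assms(1,2)
    by (simp add: D_def g_def h_def add_ac)
  have "(\<lambda>j. g (real q + 2 * real j)) \<longlonglongrightarrow> 0"
  proof -
    have "filterlim (\<lambda>j. real q + 2 * real j) at_top sequentially"
      by (intro filterlim_tendsto_add_at_top[OF tendsto_const]
          filterlim_tendsto_pos_mult_at_top[OF tendsto_const] filterlim_real_sequentially) simp
    then have "(\<lambda>j. (real q + 2 * real j) powr (1 - s)) \<longlonglongrightarrow> 0"
      using assms(1) by (intro tendsto_neg_powr) auto
    then show ?thesis unfolding g_def by (rule tendsto_divide_zero)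
  qed
  from telescope_sums'[OF this]
  have "(\<lambda>j. g (real q + 2 * real j) - g (real q + 2 * real (Suc j))) sums g (real q)"
    by simp
  then have "(\<lambda>j. D (h j)) sums g (real q)"
    by (simp add: D_def h_def algebra_simps)
  moreover have "0 \<le> D (h j)" for j
    using bound[of j] order_trans[OF powr_ge_zero] by blast
  ultimately have "((\<lambda>j. D (h j)) has_sum g (real q)) UNIV"
    by (intro sums_nonneg_imp_has_sum)
  moreover have "inj h" by (auto simp: h_def inj_on_def)
  ultimately have D: "(D has_sum g (real q)) (range h)"
    using has_sum_reindex[of h UNIV D] by (simp add: o_def)
  have Rh: "R \<subseteq> range h"
  proof
    fix m assume "m \<in> R"
    then have m: "q < m" "even (m - q)" using R by auto
    then obtain i where i: "m - q = 2 * i" by (elim evenE)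
    then have "m = h (i - 1)" using m by (simp add: h_def)
    then show "m \<in> range h" by simp
  qed
  have fD: "\<bar>f m\<bar> \<le> D m" if "m \<in> range h" for m
    using that bound f[of m] by (auto simp: h_def add_ac intro: order_trans)
  have "D summable_on R"
    using has_sum_imp_summable[OF D] Rh by (rule summable_on_subset_banach)
  then have "norm (infsum f R) \<le> infsum D R"
  proof (cases "f summable_on R")
    case True
    then show ?thesis
      using \<open>D summable_on R\<close> fD Rh by (intro norm_infsum_le[OF has_sum_infsum has_sum_infsum]) auto
  next
    \<comment> \<open>Here \<open>infsum f R\<close> is 0 by default, so nonnegativity of the bound
      suffices.\<close>
    case False
    moreover have "0 \<le> infsum D R"
      using fD Rh by (intro infsum_nonneg) (meson abs_ge_zero order_trans subsetD)
    ultimately show ?thesis by (simp add: infsum_not_exists)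
  qed
  also have "infsum D R \<le> infsum D (range h)"
    using \<open>D summable_on R\<close> has_sum_imp_summable[OF D] Rh fD
    by (intro infsum_mono2) (auto intro: order_trans[OF abs_ge_zero])
  also have "\<dots> = g (real q)" using D by (rule infsumI)
  finally show ?thesis by (simp add: g_def)
qed

section \<open>Enumeration of the primes\<close>

lemma prime_nth_prime: "prime (nth_prime k)"
  using enumerate_in_set[OF primes_infinite] by (simp add: nth_prime_def)

lemma nth_prime_Suc:
  assumes "n \<ge> 1"
  shows "nth_prime (n + 1) = (LEAST p. prime p \<and> nth_prime n < p)"
  using enumerate_Suc''[OF primes_infinite, of "n - 1"] assms by (simp add: nth_prime_def)

text \<open>Turns the product over indices in \<open>V\<close> into one over a set of primes, the
  form that the sieve takes.\<close>

lemma bij_betw_nth_prime: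
  assumes "n \<ge> 1"
  shows "bij_betw nth_prime {1..n} {p. prime p \<and> p \<le> nth_prime n}"
  unfolding bij_betw_def
proof
  \<comment> \<open>Index 0 must be excluded: truncated subtraction gives
    \<open>nth_prime 0 = nth_prime 1\<close>.\<close>
  have le_iff: "nth_prime i \<le> nth_prime j \<longleftrightarrow> i \<le> j" if "i \<ge> 1" "j \<ge> 1" for i j
    using that primes_infinite by (auto simp: nth_prime_def)
  show "inj_on nth_prime {1..n}"
    by (rule inj_onI) (metis atLeastAtMost_iff le_antisym le_iff order_refl)
  show "nth_prime ` {1..n} = {p. prime p \<and> p \<le> nth_prime n}"
  proof (intro equalityI subsetI)
    fix p assume p: "p \<in> {p. prime p \<and> p \<le> nth_prime n}"
    then obtain i where "enumerate {p. prime p} i = p"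
      using enumerate_Ex[OF primes_infinite, of p] by auto
    then have i: "p = nth_prime (Suc i)" by (simp add: nth_prime_def)
    then have "Suc i \<le> n" using p le_iff[of "Suc i" n] assms by simp
    then show "p \<in> nth_prime ` {1..n}" using i by auto
  qed (use le_iff assms in \<open>auto simp: prime_nth_prime\<close>)
qed

section \<open>The sign of \<open>V n s - 1\<close>\<close>

theorem mainTheorem4:
  fixes n :: nat and s :: real
  assumes "n \<ge> 1"
    and "s = 2 * real (nth_prime n)"
  shows "(V n s > 1 \<longrightarrow> [nth_prime (n + 1) = 1] (mod 4)) \<and>
         (V n s < 1 \<longrightarrow> [nth_prime (n + 1) = 3] (mod 4))"
proof -
  define p where "p = nth_prime n"
  define q where "q = nth_prime (n + 1)"
  define P where "P = {r. prime r \<and> r \<le> p}"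
  define f where "f = (\<lambda>m. chi4 m * real m powr - s)"
  define A where "A = {m. \<forall>r\<in>P. \<not> r dvd m}"
  define R where "R = A - {1, q}"
  have p2: "p \<ge> 2" unfolding p_def by (intro prime_ge_2_nat prime_nth_prime)
  have s: "s > 1" "s = 2 * real p" using assms(2) p2 by (simp_all add: p_def)
  have q_least: "q = (LEAST r. prime r \<and> p < r)"
    unfolding p_def q_def by (rule nth_prime_Suc[OF assms(1)])
  obtain r where r: "prime r" "p < r" "r \<le> 4 * p - 4"
    using prime_between_n_and_4n[OF p2] by blast
  have q: "prime q" "p < q" "q \<le> 4 * p - 4"
    using LeastI[of "\<lambda>r. prime r \<and> p < r" r] Least_le[of "\<lambda>r. prime r \<and> p < r" r] r
    unfolding q_least by auto
  have q_min: "q \<le> r" if "prime r" "p < r" for r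
    unfolding q_least using that by (auto intro: Least_le)
  have q_odd: "odd q" using q p2 by (auto dest!: prime_odd_nat)

  have fsum: "(f has_sum L_chi4 s) UNIV" unfolding f_def by (rule L_chi4_has_sum[OF s(1)])
  have "V n s = L_chi4 s * (\<Prod>k=1..n. 1 - f (nth_prime k))"
    by (simp add: V_def f_def)
  also have "(\<Prod>k=1..n. 1 - f (nth_prime k)) = (\<Prod>r\<in>P. 1 - f r)"
    unfolding P_def p_def by (rule prod.reindex_bij_betw[OF bij_betw_nth_prime[OF assms(1)]])
  also have "L_chi4 s = infsum f UNIV" using fsum by (simp add: infsumI)
  also have "infsum f UNIV * (\<Prod>r\<in>P. 1 - f r) = infsum f A"
    unfolding A_def
  proof (rule infsum_coprime_to_primes)
    show "f (a * b) = f a * f b" for a b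
      by (simp add: f_def chi4_mult powr_mult)
  qed (use fsum in \<open>auto simp: P_def has_sum_imp_summable\<close>)
  also have "A = insert 1 (insert q R)"
  proof -
    have "1 \<in> A" by (auto simp: A_def P_def)
    moreover have "q \<in> A"
      using q by (auto simp: A_def P_def dest: primes_dvd_imp_eq)
    ultimately show ?thesis by (auto simp: R_def)
  qed
  also have "infsum f (insert 1 (insert q R)) = f 1 + (f q + infsum f R)"
  proof -
    have "f summable_on S" for S
      using has_sum_imp_summable[OF fsum] by (rule summable_on_subset_banach) simp
    then show ?thesis
      using prime_gt_1_nat[OF q(1)] by (auto simp: infsum_insert R_def)
  qed
  finally have V: "V n s = 1 + chi4 q * real q powr - s + infsum f R"
    by (simp add: f_def chi4_def)

  \<comment> \<open>Such an \<open>m\<close> is odd because 2 lies in \<open>P\<close>, and its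
    prime factors exceed \<open>p\<close>, hence are at least \<open>q\<close>.\<close>
  have R: "R \<subseteq> {m. q < m \<and> even (m - q)}"
  proof
    fix m assume m: "m \<in> R"
    then have "m \<noteq> 1" by (simp add: R_def)
    then obtain r where r: "prime r" "r dvd m" using prime_factor_nat by blast
    have "\<not> 2 dvd m" using m p2 by (auto simp: R_def A_def P_def)
    then have "odd m" "m > 0" by (auto intro: Nat.gr0I)
    have "p < r" using m r by (auto simp: R_def A_def P_def not_le)
    then have "q \<le> r" using q_min r by blast
    then have "q \<le> m" using dvd_imp_le[OF r(2) \<open>m > 0\<close>] by linarith
    then have "q < m" using m by (auto simp: R_def)
    then show "m \<in> {m. q < m \<and> even (m - q)}" using \<open>odd m\<close> q_odd by simp
  qed
  have "\<bar>infsum f R\<bar> \<le> real q powr (1 - s) / (2 * (s - 1))"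
    using s(1) q p2 R abs_chi4_le
    by (intro abs_infsum_step_two_tail_le) (auto simp: f_def abs_mult intro!: mult_left_le_one_le)
  also have "\<dots> = real q powr - s * (real q / (2 * (s - 1)))"
    using q p2 by (simp add: powr_diff powr_minus field_simps)
  also have "\<dots> < real q powr - s * 1"
  proof (rule mult_strict_left_mono)
    have "real q \<le> 4 * real p - 4" using q(3) p2 by linarith
    then show "real q / (2 * (s - 1)) < 1" using s by simp
  qed (use q p2 in auto)
  finally have tail: "\<bar>infsum f R\<bar> < real q powr - s" by simp

  have "q mod 4 = 1 \<or> q mod 4 = 3" using q_odd by presburger
  \<comment> \<open>As \<open>V n s - 1\<close> has the sign of \<open>chi4 q\<close>, in each case
    one implication has a true conclusion and the other a false premise.\<close>
  then show ?thesis
  proof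
    assume "q mod 4 = 1"
    then show ?thesis using V tail unfolding q_def[symmetric] cong_def chi4_mod by auto
  next
    assume "q mod 4 = 3"
    then show ?thesis using V tail unfolding q_def[symmetric] cong_def chi4_mod by auto
  qed
qed

end
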